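(* Assume that the spectrum of $H^D_{(a,c)}$ is purely discrete. Let $\phi(z,x)=\alpha(z)c(z,x)+\beta(z)s(z,x)$ be a solution of $\tau u=zu$ which lies in the domain of $H$ near $a$ for every $z\in\mathbb{C}$, where $\alpha(z)$ and $\beta(z)$ are real entire functions with no common zeros. Then there is a second solution of $\tau u=zu$, $$\theta(z,x)=\gamma(z)c(z,x)+\delta(z)s(z,x),$$ where $\gamma(z)$ and $\delta(z)$ are real entire functions with no common zeros, such that $$W(\theta(z),\phi(z))=\gamma(z)\beta(z)-\alpha(z)\delta(z)=1\qquad\text{for all } z\in\mathbb{C}.$$
   Context: Let $-\infty\le a<b\le\infty$, let $q\in L^1_{\mathrm{loc}}(a,b)$ be real-valued, $\tau=-\frac{d^2}{dx^2}+q$, and let $H$ be a self-adjoint operator in $L^2(a,b)$ associated with $\tau$ with separated boundary conditions at $a$ and/or $b$. A solution lies in the domain of $H$ near $a$ if it is square integrable near $a$ and satisfies the boundary condition of $H$ at $a$ in case $\tau$ is limit circle at $a$. Fix $c\in(a,b)$; $H^D_{(a,c)}$ is the restriction of $H$ to $(a,c)$ with a Dirichlet boundary condition at $c$ (discreteness of its spectrum does not depend on $c$). The solutions $c(z,x)$, $s(z,x)$ of $\tau u=zu$ are given by the initial conditions $c(z,c)=1$, $c'(z,c)=0$, $s(z,c)=0$, $s'(z,c)=1$. $W(u,v)=u(x)v'(x)-u'(x)v(x)$ is the Wronskian. An entire function is called real if it is real-valued on $\mathbb{R}$. Under the discreteness assumption a solution $\phi(z,x)$ of the stated form exists. *)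

theory Defs
  imports "HOL-Complex_Analysis.Complex_Analysis"
begin

section \<open>Linear relations in \<open>L\<^sup>2(I)\<close>\<close>

text \<open>
  Elements of \<open>L\<^sup>2(I)\<close> are handled through representatives: two functions stand for the same
  vector if they agree almost everywhere on \<open>I\<close>; values outside \<open>I\<close> are irrelevant.
  An unbounded operator is given by its graph, a set of pairs of representatives.
\<close>

definition L2 :: "real set \<Rightarrow> (real \<Rightarrow> complex) set" where
  "L2 I = {f. set_borel_measurable lebesgue I f \<and> set_integrable lebesgue I (\<lambda>x. (norm (f x))\<^sup>2)}"

definition l2_inner :: "real set \<Rightarrow> (real \<Rightarrow> complex) \<Rightarrow> (real \<Rightarrow> complex) \<Rightarrow> complex" where
  "l2_inner I f g = set_lebesgue_integral lebesgue I (\<lambda>x. cnj (f x) * g x)"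

definition l2_norm :: "real set \<Rightarrow> (real \<Rightarrow> complex) \<Rightarrow> real" where
  "l2_norm I f = sqrt (set_lebesgue_integral lebesgue I (\<lambda>x. (norm (f x))\<^sup>2))"

type_synonym l2_graph = "((real \<Rightarrow> complex) \<times> (real \<Rightarrow> complex)) set"

definition densely_defined :: "real set \<Rightarrow> l2_graph \<Rightarrow> bool" where
  "densely_defined I G \<longleftrightarrow>
     (\<forall>h\<in>L2 I. \<forall>\<epsilon>>0. \<exists>(f, k)\<in>G. l2_norm I (\<lambda>x. h x - f x) < \<epsilon>)"

definition l2_adjoint :: "real set \<Rightarrow> l2_graph \<Rightarrow> l2_graph" where
  "l2_adjoint I G =
     {(g, h). g \<in> L2 I \<and> h \<in> L2 I \<and> (\<forall>(f, k)\<in>G. l2_inner I g k = l2_inner I h f)}"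

definition self_adjoint :: "real set \<Rightarrow> l2_graph \<Rightarrow> bool" where
  "self_adjoint I G \<longleftrightarrow> densely_defined I G \<and> l2_adjoint I G = G"

text \<open>The second conjunct yields injectivity of \<open>A - z\<close> together with boundedness of the inverse.\<close>

definition resolvent_set :: "real set \<Rightarrow> l2_graph \<Rightarrow> complex set" where
  "resolvent_set I G =
     {z. (\<forall>h\<in>L2 I. \<exists>(f, k)\<in>G. AE x\<in>I in lebesgue. k x - z * f x = h x) \<and>
         (\<exists>C. \<forall>(f, k)\<in>G. l2_norm I f \<le> C * l2_norm I (\<lambda>x. k x - z * f x))}"

definition l2_spectrum :: "real set \<Rightarrow> l2_graph \<Rightarrow> complex set" where
  "l2_spectrum I G = - resolvent_set I G"

definition eigenspace :: "real set \<Rightarrow> l2_graph \<Rightarrow> complex \<Rightarrow> (real \<Rightarrow> complex) set" where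
  "eigenspace I G z = {f. \<exists>k. (f, k) \<in> G \<and> (AE x\<in>I in lebesgue. k x = z * f x)}"

definition is_eigenvalue :: "real set \<Rightarrow> l2_graph \<Rightarrow> complex \<Rightarrow> bool" where
  "is_eigenvalue I G z \<longleftrightarrow> (\<exists>f\<in>eigenspace I G z. \<not> (AE x\<in>I in lebesgue. f x = 0))"

definition finite_multiplicity :: "real set \<Rightarrow> l2_graph \<Rightarrow> complex \<Rightarrow> bool" where
  "finite_multiplicity I G z \<longleftrightarrow>
     (\<exists>B. finite B \<and>
        (\<forall>f\<in>eigenspace I G z. \<exists>k. AE x\<in>I in lebesgue. f x = (\<Sum>b\<in>B. k b * b x)))"

definition discrete_spectrum :: "real set \<Rightarrow> l2_graph \<Rightarrow> complex set" where
  "discrete_spectrum I G =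
     {z. z isolated_in l2_spectrum I G \<and> is_eigenvalue I G z \<and> finite_multiplicity I G z}"

definition purely_discrete_spectrum :: "real set \<Rightarrow> l2_graph \<Rightarrow> bool" where
  "purely_discrete_spectrum I G \<longleftrightarrow> l2_spectrum I G = discrete_spectrum I G"


section \<open>The differential expression \<open>\<tau> = -d\<^sup>2/dx\<^sup>2 + q\<close>\<close>

definition L1_loc :: "real set \<Rightarrow> (real \<Rightarrow> real) \<Rightarrow> bool" where
  "L1_loc I q \<longleftrightarrow> (\<forall>s t. {s..t} \<subseteq> I \<longrightarrow> q absolutely_integrable_on {s..t})"

definition abs_continuous :: "real \<Rightarrow> real \<Rightarrow> (real \<Rightarrow> complex) \<Rightarrow> bool" where
  "abs_continuous u v f \<longleftrightarrow>
     (\<forall>\<epsilon>>0. \<exists>\<delta>>0. \<forall>n::nat. \<forall>s t.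
        (\<forall>i<n. u \<le> s i \<and> s i \<le> t i \<and> t i \<le> v) \<and>
        disjoint_family_on (\<lambda>i. {s i<..<t i}) {..<n} \<and>
        (\<Sum>i<n. t i - s i) < \<delta> \<longrightarrow>
        (\<Sum>i<n. norm (f (t i) - f (s i))) < \<epsilon>)"

definition AC_loc :: "real set \<Rightarrow> (real \<Rightarrow> complex) \<Rightarrow> bool" where
  "AC_loc I f \<longleftrightarrow> (\<forall>u v. {u..v} \<subseteq> I \<longrightarrow> abs_continuous u v f)"

abbreviation dx :: "(real \<Rightarrow> complex) \<Rightarrow> real \<Rightarrow> complex" where
  "dx f x \<equiv> vector_derivative f (at x)"

text \<open>Functions \<open>f\<close> on \<open>I\<close> with \<open>f, f' \<in> AC\<^sub>l\<^sub>o\<^sub>c(I)\<close>, to which \<open>\<tau>\<close> can be applied.\<close>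

definition dom_tau :: "real set \<Rightarrow> (real \<Rightarrow> complex) set" where
  "dom_tau I = {f. (\<forall>x\<in>I. f differentiable at x) \<and> AC_loc I f \<and> AC_loc I (dx f)}"

text \<open>\<open>\<tau> f = g\<close> almost everywhere on \<open>I\<close>, that is, \<open>f''\<close> exists and equals \<open>q f - g\<close>.\<close>

definition tau_eq ::
  "real set \<Rightarrow> (real \<Rightarrow> real) \<Rightarrow> (real \<Rightarrow> complex) \<Rightarrow> (real \<Rightarrow> complex) \<Rightarrow> bool" where
  "tau_eq I q f g \<longleftrightarrow>
     (AE x\<in>I in lebesgue. (dx f has_vector_derivative (of_real (q x) * f x - g x)) (at x))"

definition solution :: "real set \<Rightarrow> (real \<Rightarrow> real) \<Rightarrow> complex \<Rightarrow> (real \<Rightarrow> complex) \<Rightarrow> bool" where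
  "solution I q z u \<longleftrightarrow> u \<in> dom_tau I \<and> tau_eq I q u (\<lambda>x. z * u x)"

definition wronskian :: "(real \<Rightarrow> complex) \<Rightarrow> (real \<Rightarrow> complex) \<Rightarrow> real \<Rightarrow> complex" where
  "wronskian u v x = u x * dx v x - dx u x * v x"


section \<open>Boundary conditions and self-adjoint realizations\<close>

text \<open>An endpoint of the interval, possibly infinite, is represented by a filter \<open>E\<close> on the reals.\<close>

definition left_end :: "ereal \<Rightarrow> real filter" where
  "left_end a = filtermap real_of_ereal (at_right a)"

definition right_end :: "ereal \<Rightarrow> real filter" where
  "right_end b = filtermap real_of_ereal (at_left b)"

definition L2_near :: "real filter \<Rightarrow> (real \<Rightarrow> complex) \<Rightarrow> bool" where
  "L2_near E f \<longleftrightarrow> (\<exists>S. eventually (\<lambda>x. x \<in> S) E \<and> f \<in> L2 S)"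

definition limit_circle :: "real set \<Rightarrow> (real \<Rightarrow> real) \<Rightarrow> real filter \<Rightarrow> bool" where
  "limit_circle I q E \<longleftrightarrow> (\<forall>z u. solution I q z u \<longrightarrow> L2_near E u)"

definition max_dom :: "real set \<Rightarrow> (real \<Rightarrow> real) \<Rightarrow> (real \<Rightarrow> complex) set" where
  "max_dom I q = {f. f \<in> dom_tau I \<and> f \<in> L2 I \<and> (\<exists>g\<in>L2 I. tau_eq I q f g)}"

text \<open>
  In the limit circle case a separated boundary condition at \<open>E\<close> has the form \<open>W\<^sub>E(v, f) = 0\<close>, where
  \<open>v\<close> is in the maximal domain, \<open>W\<^sub>E(v*, v) = 0\<close>, and \<open>W\<^sub>E(v, f) \<noteq> 0\<close> for some \<open>f\<close> in the maximal
  domain. In the limit point case there is no such \<open>v\<close>, and no condition is imposed.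
\<close>

definition boundary_function ::
  "real set \<Rightarrow> (real \<Rightarrow> real) \<Rightarrow> real filter \<Rightarrow> (real \<Rightarrow> complex) \<Rightarrow> bool" where
  "boundary_function I q E v \<longleftrightarrow>
     v \<in> max_dom I q \<and>
     (wronskian (\<lambda>x. cnj (v x)) v \<longlongrightarrow> 0) E \<and>
     (\<exists>f\<in>max_dom I q. \<not> (wronskian v f \<longlongrightarrow> 0) E)"

definition boundary_condition ::
  "real set \<Rightarrow> (real \<Rightarrow> real) \<Rightarrow> real filter \<Rightarrow> (real \<Rightarrow> complex) \<Rightarrow> (real \<Rightarrow> complex) \<Rightarrow> bool" where
  "boundary_condition I q E v f \<longleftrightarrow> (limit_circle I q E \<longrightarrow> (wronskian v f \<longlongrightarrow> 0) E)"

text \<open>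
  The graph of the operator \<open>f \<mapsto> \<tau> f\<close> in \<open>L\<^sup>2(I)\<close> whose domain consists of the functions in the
  maximal domain that satisfy \<open>B\<close>. The condition is imposed on the representative \<open>u\<close> with
  \<open>u, u' \<in> AC\<^sub>l\<^sub>o\<^sub>c(I)\<close>.
\<close>

definition tau_graph ::
  "real set \<Rightarrow> (real \<Rightarrow> real) \<Rightarrow> ((real \<Rightarrow> complex) \<Rightarrow> bool) \<Rightarrow> l2_graph" where
  "tau_graph I q B =
     {(f, g). f \<in> L2 I \<and> g \<in> L2 I \<and>
        (\<exists>u\<in>dom_tau I. (AE x\<in>I in lebesgue. f x = u x) \<and> tau_eq I q u g \<and> B u)}"

definition sl_operator ::
  "ereal \<Rightarrow> ereal \<Rightarrow> (real \<Rightarrow> real) \<Rightarrow> (real \<Rightarrow> complex) \<Rightarrow> (real \<Rightarrow> complex) \<Rightarrow> l2_graph" where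
  "sl_operator a b q v w =
     (let I = einterval a b in
      tau_graph I q
        (\<lambda>u. boundary_condition I q (left_end a) v u \<and> boundary_condition I q (right_end b) w u))"

definition separated_realization ::
  "ereal \<Rightarrow> ereal \<Rightarrow> (real \<Rightarrow> real) \<Rightarrow> (real \<Rightarrow> complex) \<Rightarrow> (real \<Rightarrow> complex) \<Rightarrow> l2_graph \<Rightarrow> bool" where
  "separated_realization a b q v w H \<longleftrightarrow>
     (let I = einterval a b in
      H = sl_operator a b q v w \<and> self_adjoint I H \<and>
      (limit_circle I q (left_end a) \<longrightarrow> boundary_function I q (left_end a) v) \<and>
      (limit_circle I q (right_end b) \<longrightarrow> boundary_function I q (right_end b) w))"

text \<open>
  \<open>H\<^sup>D\<close> on \<open>(a,c)\<close>: the condition of \<open>H\<close> at \<open>a\<close> (present if and only if \<open>\<tau>\<close> on \<open>(a,b)\<close> is limit circle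
  at \<open>a\<close>) is kept, and \<open>f(c) = 0\<close> is imposed at the regular endpoint \<open>c\<close>.
\<close>

definition dirichlet_restriction ::
  "ereal \<Rightarrow> ereal \<Rightarrow> (real \<Rightarrow> real) \<Rightarrow> (real \<Rightarrow> complex) \<Rightarrow> real \<Rightarrow> l2_graph" where
  "dirichlet_restriction a b q v c =
     tau_graph (einterval a (ereal c)) q
       (\<lambda>u. boundary_condition (einterval a b) q (left_end a) v u \<and> (u \<longlongrightarrow> 0) (at_left c))"

definition in_domain_near ::
  "real set \<Rightarrow> (real \<Rightarrow> real) \<Rightarrow> real filter \<Rightarrow> (real \<Rightarrow> complex) \<Rightarrow> (real \<Rightarrow> complex) \<Rightarrow> bool" where
  "in_domain_near I q E v u \<longleftrightarrow> L2_near E u \<and> boundary_condition I q E v u"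


definition real_entire :: "(complex \<Rightarrow> complex) \<Rightarrow> bool" where
  "real_entire f \<longleftrightarrow> f holomorphic_on UNIV \<and> (\<forall>x\<in>\<real>. f x \<in> \<real>)"

definition no_common_zeros :: "(complex \<Rightarrow> complex) \<Rightarrow> (complex \<Rightarrow> complex) \<Rightarrow> bool" where
  "no_common_zeros f g \<longleftrightarrow> (\<nexists>z. f z = 0 \<and> g z = 0)"

end

(*
  The coefficients come from the Bezout identity for entire functions without common zeros.
  On a ball one of the functions is a product of finitely many linear factors and a nonvanishing
  function, and solvability of the identity is multiplicative, so it can be solved there. Two
  solutions on a ball differ by a holomorphic multiple of a fixed pair, which can be approximated by
  an entire multiple; hence solutions on growing balls can be corrected so as to converge locally
  uniformly. Averaging u with its conjugate cnj (u (cnj z)) makes the coefficients real.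
  The Wronskian of two solutions is locally absolutely continuous with derivative zero almost
  everywhere, hence constant.
*)

theory Submission
  imports Defs
begin

section \<open>Coprime entire functions\<close>

definition bezout_pair ::
  "complex set \<Rightarrow> (complex \<Rightarrow> complex) \<Rightarrow> (complex \<Rightarrow> complex) \<Rightarrow>
     (complex \<Rightarrow> complex) \<Rightarrow> (complex \<Rightarrow> complex) \<Rightarrow> bool" where
  "bezout_pair S f g u v \<longleftrightarrow>
     u holomorphic_on S \<and> v holomorphic_on S \<and> (\<forall>z\<in>S. u z * f z + v z * g z = 1)"

text \<open>Units modulo \<open>g\<close> are closed under products: multiply the two identities.
  The only term free of \<open>g\<close> is \<open>u1 u2 f1 f2\<close>, and the cofactors of
  \<open>g\<close> in the others add up to \<open>?v\<close>.\<close>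

lemma bezout_pair_mult:
  assumes "bezout_pair S f1 g u1 v1" "bezout_pair S f2 g u2 v2"
    and "f1 holomorphic_on S" "f2 holomorphic_on S" "g holomorphic_on S"
  shows "\<exists>u v. bezout_pair S (\<lambda>z. f1 z * f2 z) g u v"
proof (intro exI)
  let ?u = "\<lambda>z. u1 z * u2 z"
  let ?v = "\<lambda>z. u1 z * f1 z * v2 z + v1 z * u2 z * f2 z + v1 z * v2 z * g z"
  have "?u z * (f1 z * f2 z) + ?v z * g z = 1" if "z \<in> S" for z
  proof -
    have "(u1 z * f1 z + v1 z * g z) * (u2 z * f2 z + v2 z * g z) = 1"
      using assms(1,2) that by (simp add: bezout_pair_def)
    thus ?thesis by (simp add: algebra_simps)
  qed
  thus "bezout_pair S (\<lambda>z. f1 z * f2 z) g ?u ?v"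
    using assms by (auto simp: bezout_pair_def intro!: holomorphic_intros)
qed

text \<open>The difference quotient \<open>F\<close> of \<open>g\<close> at \<open>r\<close>
  satisfies \<open>g z = g r + F z (z - r)\<close>. Dividing by \<open>g r\<close> gives the
  identity, and the value \<open>deriv g r\<close> at \<open>r\<close> removes the singularity of
  \<open>F\<close>.\<close>

lemma bezout_pair_linear:
  assumes "g holomorphic_on S" "open S" "g r \<noteq> 0"
  shows "\<exists>u v. bezout_pair S (\<lambda>z. z - r) g u v"
proof (intro exI)
  let ?F = "\<lambda>z. if z = r then deriv g r else (g z - g r) / (z - r)"
  have "?F holomorphic_on S"
    using assms by (intro pole_lemma_open)
  moreover have "- ?F z / g r * (z - r) + 1 / g r * g z = 1" for z
    using assms(3) by (simp add: field_simps)
  ultimately show "bezout_pair S (\<lambda>z. z - r) g (\<lambda>z. - ?F z / g r) (\<lambda>z. 1 / g r)"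
    using assms(3) unfolding bezout_pair_def by (intro conjI ballI holomorphic_intros) auto
qed

lemma bezout_pair_power:
  assumes "g holomorphic_on S" "open S" "g r \<noteq> 0"
  shows "\<exists>u v. bezout_pair S (\<lambda>z. (z - r) ^ n) g u v"
proof (induction n)
  case 0
  have "bezout_pair S (\<lambda>z. (z - r) ^ 0) g (\<lambda>_. 1) (\<lambda>_. 0)"
    by (simp add: bezout_pair_def)
  thus ?case by blast
next
  case (Suc n)
  obtain u v u' v' where "bezout_pair S (\<lambda>z. z - r) g u v"
      "bezout_pair S (\<lambda>z. (z - r) ^ n) g u' v'"
    using Suc bezout_pair_linear[OF assms] by blast
  thus ?case
    unfolding power_Suc using assms(1) by (intro bezout_pair_mult) (auto intro!: holomorphic_intros)
qed

text \<open>The local factorization at a zero gives the order \<open>n\<close> and a quotient only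
  on a ball around \<open>r\<close>. It agrees there with \<open>f w / (w - r) ^ n\<close> off
  \<open>r\<close>, so the two glue to an entire quotient, from which further zeros can be split
  off.\<close>

lemma entire_factor_zero:
  assumes f: "f holomorphic_on UNIV" and r: "f r = 0" and nz: "\<exists>w. f w \<noteq> 0"
  obtains n g where "g holomorphic_on UNIV" "g r \<noteq> 0" "\<And>z. f z = (z - r) ^ n * g z"
proof -
  have "\<not> f constant_on UNIV"
  proof
    assume "f constant_on UNIV"
    then obtain y where "\<And>x. f x = y"
      by (auto simp: constant_on_def)
    with r nz show False by simp
  qed
  then obtain h e n where n: "0 < n" "0 < e" and h: "h holomorphic_on ball r e"
    and fh: "\<And>w. w \<in> ball r e \<Longrightarrow> f w = (w - r) ^ n * h w"
    and h0: "\<And>w. w \<in> ball r e \<Longrightarrow> h w \<noteq> 0"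
    by (rule holomorphic_factor_zero_nonconstant[OF f open_UNIV connected_UNIV UNIV_I r]) (rule that; simp)
  define g where "g = (\<lambda>w. if w \<in> ball r e then h w else f w / (w - r) ^ n)"
  have g1: "g w = f w / (w - r) ^ n" if "w \<noteq> r" for w
    using that fh by (auto simp: g_def)
  have "g holomorphic_on (ball r e \<union> - {r})"
  proof (rule holomorphic_on_Un)
    show "g holomorphic_on ball r e"
      using h by (rule holomorphic_transform) (simp add: g_def)
    have "(\<lambda>w. f w / (w - r) ^ n) holomorphic_on - {r}"
      by (intro holomorphic_intros holomorphic_on_subset[OF f]) auto
    thus "g holomorphic_on - {r}"
      by (rule holomorphic_transform) (simp add: g1)
  qed auto
  moreover have "ball r e \<union> - {r} = UNIV"
    using n by auto
  ultimately have "g holomorphic_on UNIV" by simp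
  moreover have "g r \<noteq> 0"
    using n h0 by (simp add: g_def)
  moreover have "f z = (z - r) ^ n * g z" for z
    using r n(1) g1[of z] by (cases "z = r") auto
  ultimately show ?thesis by (rule that)
qed

text \<open>Induction on \<open>Z\<close> with \<open>f\<close> generalized. Dividing out
  \<open>r\<close> with its full multiplicity leaves a quotient whose zeros in \<open>S\<close> lie
  in the smaller set; the power of \<open>z - r\<close> is restored by
  \<open>bezout_pair_mult\<close>. Without zeros in \<open>S\<close>, the pair
  \<open>(1 / f, 0)\<close> works. \<open>Z\<close> may contain points that are not zeros of
  \<open>f\<close>, hence the case distinction.\<close>

lemma bezout_pair_finite_zeros:
  assumes "finite Z" "f holomorphic_on UNIV" "\<exists>w. f w \<noteq> 0" "\<And>z. z \<in> S \<Longrightarrow> f z = 0 \<Longrightarrow> z \<in> Z"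
    and g: "g holomorphic_on UNIV" and nc: "\<And>z. f z = 0 \<Longrightarrow> g z \<noteq> 0" and S: "open S"
  shows "\<exists>u v. bezout_pair S f g u v"
  using assms(1-4) nc
proof (induction Z arbitrary: f rule: finite_induct)
  case empty
  have "bezout_pair S f g (\<lambda>z. 1 / f z) (\<lambda>_. 0)"
    using empty holomorphic_on_subset[OF empty(1)]
    unfolding bezout_pair_def by (intro conjI ballI holomorphic_intros) auto
  thus ?case by blast
next
  case (insert r Z)
  show ?case
  proof (cases "f r = 0")
    case False
    have "z \<in> Z" if "z \<in> S" "f z = 0" for z
      using insert.prems(3)[OF that] that False by auto
    from insert.IH[OF insert.prems(1,2) this insert.prems(4)] show ?thesis by blast
  next
    case True
    obtain n h where h: "h holomorphic_on UNIV" "h r \<noteq> 0" and fh: "\<And>z. f z = (z - r) ^ n * h z"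
      using entire_factor_zero[OF insert.prems(1) True insert.prems(2)] by blast
    have "z \<in> Z" if "z \<in> S" "h z = 0" for z
      using insert.prems(3)[of z] that fh h(2) by auto
    moreover have "g z \<noteq> 0" if "h z = 0" for z
      using insert.prems(4)[of z] that fh by simp
    ultimately obtain u v where "bezout_pair S h g u v"
      using insert.IH[of h] h by blast
    moreover have gS: "g holomorphic_on S" "h holomorphic_on S"
      using g h(1) holomorphic_on_subset by blast+
    moreover obtain u' v' where "bezout_pair S (\<lambda>z. (z - r) ^ n) g u' v'"
      using bezout_pair_power[OF gS(1) S insert.prems(4)[OF True]] by blast
    ultimately have "\<exists>u v. bezout_pair S (\<lambda>z. (z - r) ^ n * h z) g u v"
      by (intro bezout_pair_mult) (auto intro!: holomorphic_intros)
    moreover have "f = (\<lambda>z. (z - r) ^ n * h z)"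
      using fh by auto
    ultimately show ?thesis by simp
  qed
qed

text \<open>A nonconstant entire function has finitely many zeros in the compact closed ball. The
  constants are treated apart: for \<open>f = 0\<close> the coprimality makes \<open>g\<close>
  zero-free, so \<open>1 / g\<close> is a coefficient.\<close>

lemma bezout_pair_ball:
  assumes f: "f holomorphic_on UNIV" and g: "g holomorphic_on UNIV"
    and nc: "\<And>z. f z = 0 \<Longrightarrow> g z \<noteq> 0"
  shows "\<exists>u v. bezout_pair (ball 0 R) f g u v"
proof (cases "f constant_on UNIV")
  case False
  have "finite {z \<in> cball 0 R. f z = 0}"
    using f False by (intro holomorphic_compact_finite_zeros[of f UNIV]) auto
  moreover have "\<exists>w. f w \<noteq> 0"
    using False unfolding constant_on_def by metis
  ultimately show ?thesis
    using f g nc by (intro bezout_pair_finite_zeros[of "{z \<in> cball 0 R. f z = 0}"]) auto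
next
  case True
  then obtain c where c: "\<And>z. f z = c"
    unfolding constant_on_def by auto
  show ?thesis
  proof (cases "c = 0")
    case True
    have "bezout_pair (ball 0 R) f g (\<lambda>_. 0) (\<lambda>z. 1 / g z)"
      using nc c True holomorphic_on_subset[OF g]
      unfolding bezout_pair_def by (intro conjI ballI holomorphic_intros) auto
    thus ?thesis by blast
  next
    case False
    have "bezout_pair (ball 0 R) f g (\<lambda>_. 1 / c) (\<lambda>_. 0)"
      using c False by (simp add: bezout_pair_def)
    thus ?thesis by blast
  qed
qed

section \<open>From balls to the whole plane\<close>

text \<open>Taylor polynomials at 0 converge uniformly on smaller closed balls, and a polynomial is
  entire.\<close>

lemma holomorphic_ball_approx_entire:
  assumes f: "f holomorphic_on ball 0 R" and "0 \<le> r" "r < R" "e > 0"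
  obtains p where "p holomorphic_on UNIV" "\<And>z. z \<in> cball 0 r \<Longrightarrow> norm (f z - p z) < e"
proof -
  define a where "a = (\<lambda>n. (deriv ^^ n) f 0 / fact n)"
  have sums: "(\<lambda>n. a n * w ^ n) sums f w" if "norm w < R" for w
    using holomorphic_power_series[OF f, of w] that by (simp add: a_def)
  \<comment> \<open>The midpoint is a point where the series converges and whose modulus exceeds
    \<open>r\<close>; this puts \<open>r\<close> strictly below the radius of convergence.\<close>
  have "ereal r < ereal ((r + R) / 2)"
    using assms by simp
  also have "(r + R) / 2 = norm (of_real ((r + R) / 2) :: complex)"
    unfolding norm_of_real using assms by simp
  also have "ereal \<dots> \<le> conv_radius a"
    using assms by (intro conv_radius_geI sums_summable[OF sums]) (simp only: norm_of_real, simp)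
  finally have "uniform_limit (cball 0 r) (\<lambda>n x. \<Sum>i<n. a i * (x - 0) ^ i)
                  (\<lambda>x. \<Sum>i. a i * (x - 0) ^ i) sequentially"
    by (rule powser_uniform_limit)
  from eventually_happens'[OF sequentially_bot uniform_limitD[OF this \<open>e > 0\<close>]] obtain n where n:
    "\<And>z. z \<in> cball 0 r \<Longrightarrow> dist (\<Sum>i<n. a i * z ^ i) (\<Sum>i. a i * z ^ i) < e"
    unfolding diff_zero by blast
  show ?thesis
  proof
    show "(\<lambda>z. \<Sum>i<n. a i * z ^ i) holomorphic_on UNIV"
      by (intro holomorphic_intros)
    show "norm (f z - (\<Sum>i<n. a i * z ^ i)) < e" if "z \<in> cball 0 r" for z
      using n[OF that] sums_unique[OF sums, of z] that assms by (simp add: dist_norm norm_minus_commute)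
  qed
qed

text \<open>
  On the smaller ball two Bezout pairs differ by a multiple \<open>h\<close> of \<open>(g, -f)\<close>, where
  \<open>h = u' v - u v'\<close>. Replacing \<open>h\<close> by an entire approximation corrects the pair on the larger ball.
\<close>

lemma bezout_pair_extend:
  assumes uv: "bezout_pair (ball 0 R) f g u v" and r: "0 \<le> r" "r < R" "R \<le> R'" and "e > 0"
    and f: "f holomorphic_on UNIV" and g: "g holomorphic_on UNIV" and nc: "\<And>z. f z = 0 \<Longrightarrow> g z \<noteq> 0"
  shows "\<exists>u' v'. bezout_pair (ball 0 R') f g u' v' \<and>
           (\<forall>z\<in>cball 0 r. norm (u' z - u z) < e \<and> norm (v' z - v z) < e)"
proof -
  obtain u1 v1 where uv1: "bezout_pair (ball 0 R') f g u1 v1"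
    using bezout_pair_ball[OF f g nc] by blast
  define h where "h = (\<lambda>z. u1 z * v z - u z * v1 z)"
  have sub: "ball (0::complex) R \<subseteq> ball 0 R'"
    using r by (simp add: subset_ball)
  have eq: "u z * f z + v z * g z = 1" "u1 z * f z + v1 z * g z = 1" if "norm z < R" for z
    using uv uv1 that r by (auto simp: bezout_pair_def)
  \<comment> \<open>Multiply \<open>u1\<close> by the identity for \<open>(u, v)\<close>,
    \<open>u\<close> by the one for \<open>(u1, v1)\<close>, and subtract: the terms with
    \<open>f\<close> cancel. The formula for \<open>v1 - v\<close> arises in the same way.\<close>
  have hu: "u1 z - u z = g z * h z" if "norm z < R" for z
    using eq[OF that] unfolding h_def by algebra
  have hv: "v1 z - v z = - f z * h z" if "norm z < R" for z
    using eq[OF that] unfolding h_def by algebra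
  have "h holomorphic_on ball 0 R"
    using uv uv1 holomorphic_on_subset[OF _ sub] unfolding h_def bezout_pair_def
    by (intro holomorphic_intros) auto
  have cont: "continuous_on (cball 0 r) f" "continuous_on (cball 0 r) g"
    using holomorphic_on_subset[OF f] holomorphic_on_subset[OF g]
    by (auto intro!: holomorphic_on_imp_continuous_on)
  have "bounded (f ` cball 0 r)" "bounded (g ` cball 0 r)"
    by (intro compact_imp_bounded compact_continuous_image cont compact_cball)+
  then obtain M1 M2 where M: "\<And>z. z \<in> cball 0 r \<Longrightarrow> norm (f z) \<le> M1"
    "\<And>z. z \<in> cball 0 r \<Longrightarrow> norm (g z) \<le> M2"
    unfolding bounded_iff by blast
  \<comment> \<open>The final errors are \<open>g (h - t)\<close> and \<open>- f (h - t)\<close>, so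
    accuracy \<open>e / M\<close> for \<open>h\<close> suffices; the summand 1 makes
    \<open>M\<close> positive.\<close>
  define M where "M = \<bar>M1\<bar> + \<bar>M2\<bar> + 1"
  have M': "M > 0" "\<And>z. z \<in> cball 0 r \<Longrightarrow> norm (f z) \<le> M" "\<And>z. z \<in> cball 0 r \<Longrightarrow> norm (g z) \<le> M"
    using M by (fastforce simp: M_def)+
  obtain t where t: "t holomorphic_on UNIV" and ht: "\<And>z. z \<in> cball 0 r \<Longrightarrow> norm (h z - t z) < e / M"
    using holomorphic_ball_approx_entire[OF \<open>h holomorphic_on _\<close> r(1,2), of "e / M"] \<open>e > 0\<close> M'(1)
    by auto
  have small: "norm (k * (h z - t z)) < e" if "z \<in> cball 0 r" "norm k \<le> M" for z k
  proof -
    have "norm (k * (h z - t z)) \<le> M * norm (h z - t z)"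
      unfolding norm_mult by (intro mult_right_mono that) simp
    also have "\<dots> < M * (e / M)"
      using ht[OF that(1)] M'(1) by (intro mult_strict_left_mono)
    finally show ?thesis using M'(1) by simp
  qed
  define u2 where "u2 = (\<lambda>z. u1 z - g z * t z)"
  define v2 where "v2 = (\<lambda>z. v1 z + f z * t z)"
  have "u2 z * f z + v2 z * g z = u1 z * f z + v1 z * g z" for z
    unfolding u2_def v2_def by (simp add: algebra_simps)
  hence "bezout_pair (ball 0 R') f g u2 v2"
    using uv1 holomorphic_on_subset[OF f] holomorphic_on_subset[OF g] holomorphic_on_subset[OF t]
    unfolding bezout_pair_def u2_def v2_def by (auto intro!: holomorphic_intros)
  moreover have "norm (u2 z - u z) < e \<and> norm (v2 z - v z) < e" if z: "z \<in> cball 0 r" for z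
  proof -
    have zR: "norm z < R" using z r by simp
    have "u2 z - u z = g z * (h z - t z)"
      using hu[OF zR] unfolding u2_def by (simp add: algebra_simps)
    moreover have "v2 z - v z = - f z * (h z - t z)"
      using hv[OF zR] unfolding v2_def by (simp add: algebra_simps)
    moreover have "norm (- f z) \<le> M"
      using M'(2)[OF z] by simp
    ultimately show ?thesis
      using small[OF z] M'(3)[OF z] by metis
  qed
  ultimately show ?thesis by blast
qed

text \<open>On \<open>cball 0 m\<close> the increments are controlled from index \<open>m\<close>
  on, so the telescoping series converges uniformly by the M-test and its limit is holomorphic
  inside. These balls exhaust the plane. Radius \<open>n + 1\<close> in the first assumption keeps
  \<open>F n\<close> continuous on the closed ball of radius \<open>n\<close>.\<close>

lemma entire_limit:
  fixes F :: "nat \<Rightarrow> complex \<Rightarrow> complex"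
  assumes hol: "\<And>n. F n holomorphic_on ball 0 (real n + 1)"
    and diff: "\<And>n z. z \<in> cball 0 (real n) \<Longrightarrow> norm (F (Suc n) z - F n z) \<le> (1/2) ^ n"
  obtains G where "G holomorphic_on UNIV" "\<And>z. (\<lambda>n. F n z) \<longlonglongrightarrow> G z"
proof
  \<comment> \<open>The pointwise \<open>lim\<close> does not depend on \<open>m\<close>, so the
    uniform limits found on the different balls are restrictions of one function.\<close>
  define G where "G = (\<lambda>z. lim (\<lambda>n. F n z))"
  have main: "uniform_limit (cball 0 (real m)) (\<lambda>n. F (n + m)) G sequentially" for m
  proof -
    define D where "D = (\<lambda>n z. F (Suc n + m) z - F (n + m) z)"
    have "norm (D n z) \<le> (1/2) ^ (n + m)" if "z \<in> cball 0 (real m)" for n z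
      unfolding D_def using diff[of z "n + m"] that by simp
    hence "uniform_limit (cball 0 (real m)) (\<lambda>n z. \<Sum>i<n. D i z) (\<lambda>z. \<Sum>i. D i z) sequentially"
      by (rule Weierstrass_m_test) (auto simp: power_add intro!: summable_mult2 summable_geometric)
    hence "uniform_limit (cball 0 (real m)) (\<lambda>n z. F m z + (\<Sum>i<n. D i z))
             (\<lambda>z. F m z + (\<Sum>i. D i z)) sequentially"
      by (intro uniform_limit_intros)
    moreover have "F m z + (\<Sum>i<n. D i z) = F (n + m) z" for n z
      unfolding D_def using sum_lessThan_telescope[of "\<lambda>i. F (i + m) z" n] by simp
    ultimately have *: "uniform_limit (cball 0 (real m)) (\<lambda>n. F (n + m)) (\<lambda>z. F m z + (\<Sum>i. D i z)) sequentially"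
      by simp
    have "F m z + (\<Sum>i. D i z) = G z" if "z \<in> cball 0 (real m)" for z
    proof -
      have "(\<lambda>n. F (n + m) z) \<longlonglongrightarrow> F m z + (\<Sum>i. D i z)"
        using tendsto_uniform_limitI[OF * that] .
      hence "(\<lambda>n. F n z) \<longlonglongrightarrow> F m z + (\<Sum>i. D i z)"
        by (rule LIMSEQ_offset)
      thus ?thesis unfolding G_def by (simp add: limI)
    qed
    with * show ?thesis
      by (subst (asm) uniform_limit_cong'[where g = "\<lambda>n. F (n + m)" and i = G]) auto
  qed
  show "(\<lambda>n. F n z) \<longlonglongrightarrow> G z" for z
  proof -
    obtain m :: nat where "norm z \<le> real m"
      using real_arch_simple by blast
    hence "(\<lambda>n. F (n + m) z) \<longlonglongrightarrow> G z"
      using tendsto_uniform_limitI[OF main, of z m] by simp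
    thus ?thesis by (rule LIMSEQ_offset)
  qed
  have "G holomorphic_on ball 0 (real m)" for m
  proof (rule holomorphic_uniform_limit[OF _ main])
    show "\<forall>\<^sub>F n in sequentially. continuous_on (cball 0 (real m)) (F (n + m)) \<and>
            F (n + m) holomorphic_on ball 0 (real m)"
    proof (intro always_eventually allI conjI)
      show "continuous_on (cball 0 (real m)) (F (n + m))" for n
        by (rule holomorphic_on_imp_continuous_on, rule holomorphic_on_subset[OF hol]) auto
      show "F (n + m) holomorphic_on ball 0 (real m)" for n
        by (rule holomorphic_on_subset[OF hol]) auto
    qed
  qed auto
  hence "G holomorphic_on (\<Union>m. ball 0 (real m))"
    by (intro holomorphic_on_UN_open) auto
  moreover have "(\<Union>m. ball (0::complex) (real m)) = UNIV"
    using reals_Archimedean2 by auto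
  ultimately show "G holomorphic_on UNIV" by simp
qed

theorem entire_bezout:
  assumes f: "f holomorphic_on UNIV" and g: "g holomorphic_on UNIV"
    and nc: "\<And>z. f z = 0 \<Longrightarrow> g z \<noteq> 0"
  shows "\<exists>u v. bezout_pair UNIV f g u v"
proof -
  \<comment> \<open>The pair with index \<open>n\<close> lives on radius \<open>n + 1\<close> but is
    compared with its successor on radius \<open>n\<close> only: \<open>bezout_pair_extend\<close>
    needs a gap between the two radii.\<close>
  let ?P = "\<lambda>n p. bezout_pair (ball 0 (real n + 1)) f g (fst p) (snd p)"
  let ?Q = "\<lambda>n p p'. \<forall>z\<in>cball 0 (real n). norm (fst p' z - fst p z) < (1/2) ^ n \<and>
                                   norm (snd p' z - snd p z) < (1/2) ^ n"
  have "\<exists>P. \<forall>n. ?P n (P n) \<and> ?Q n (P n) (P (Suc n))"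
  proof (rule dependent_nat_choice)
    show "\<exists>p. ?P 0 p"
      using bezout_pair_ball[OF f g nc] by auto
    show "\<exists>p'. ?P (Suc n) p' \<and> ?Q n p p'" if "?P n p" for n p
      using bezout_pair_extend[OF that, of "real n" "real (Suc n) + 1" "(1/2) ^ n"] f g nc by auto
  qed
  then obtain P where P: "\<And>n. ?P n (P n)" "\<And>n. ?Q n (P n) (P (Suc n))"
    by blast
  have lim: "\<exists>G. G holomorphic_on UNIV \<and> (\<forall>z. (\<lambda>n. pr (P n) z) \<longlonglongrightarrow> G z)"
    if "pr = fst \<or> pr = snd" for pr
  proof -
    have hol: "pr (P n) holomorphic_on ball 0 (real n + 1)" for n
      using P(1)[of n] that by (auto simp: bezout_pair_def)
    have diff: "norm (pr (P (Suc n)) z - pr (P n) z) \<le> (1/2) ^ n" if z: "z \<in> cball 0 (real n)" for n z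
      using P(2)[of n] z \<open>pr = fst \<or> pr = snd\<close> by (auto intro: less_imp_le)
    show ?thesis
      by (rule entire_limit[OF hol diff]) auto
  qed
  obtain u where u: "u holomorphic_on UNIV" "\<And>z. (\<lambda>n. fst (P n) z) \<longlonglongrightarrow> u z"
    using lim[of fst] by auto
  obtain v where v: "v holomorphic_on UNIV" "\<And>z. (\<lambda>n. snd (P n) z) \<longlonglongrightarrow> v z"
    using lim[of snd] by auto
  have "u z * f z + v z * g z = 1" for z
  proof (rule LIMSEQ_unique)
    show "(\<lambda>n. fst (P n) z * f z + snd (P n) z * g z) \<longlonglongrightarrow> u z * f z + v z * g z"
      by (intro tendsto_intros u v)
    obtain m :: nat where m: "norm z \<le> real m"
      using real_arch_simple by blast
    \<comment> \<open>At a fixed \<open>z\<close> the identity is available once the ball of radius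
      \<open>n + 1\<close> contains \<open>z\<close>, so the sequence is eventually
      constant.\<close>
    have "fst (P n) z * f z + snd (P n) z * g z = 1" if "n \<ge> m" for n
      using P(1)[of n] m that by (auto simp: bezout_pair_def)
    thus "(\<lambda>n. fst (P n) z * f z + snd (P n) z * g z) \<longlonglongrightarrow> 1"
      by (intro tendsto_eventually) (auto simp: eventually_sequentially)
  qed
  with u v show ?thesis
    unfolding bezout_pair_def by blast
qed

section \<open>Real coefficients by reflection\<close>

text \<open>The reflected function is entire and agrees with \<open>f\<close> on the real line,
  which accumulates at 0; the identity theorem makes the two equal.\<close>

lemma real_entire_cnj:
  assumes "real_entire f"
  shows "f (cnj z) = cnj (f z)"
proof -
  have f: "f holomorphic_on UNIV" "\<And>x. x \<in> \<real> \<Longrightarrow> f x \<in> \<real>"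
    using assms by (auto simp: real_entire_def)
  have "(cnj \<circ> f \<circ> cnj) z - f z = 0"
  proof (rule analytic_continuation[where f = "\<lambda>z. (cnj \<circ> f \<circ> cnj) z - f z" and S = UNIV and U = "\<real>" and \<xi> = 0])
    show "(\<lambda>z. (cnj \<circ> f \<circ> cnj) z - f z) holomorphic_on UNIV"
      by (intro holomorphic_on_diff holomorphic_on_compose_cnj_cnj f(1) holomorphic_on_subset[OF f(1)]) auto
    show "(0::complex) islimpt \<real>"
      unfolding islimpt_approachable
    proof (intro allI impI)
      fix e :: real assume "e > 0"
      thus "\<exists>x'\<in>\<real>. x' \<noteq> (0::complex) \<and> dist x' 0 < e"
        by (intro bexI[of _ "of_real (e / 2)"]) (auto simp: Reals_of_real)
    qed
    show "(cnj \<circ> f \<circ> cnj) z - f z = 0" if "z \<in> \<real>" for z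
      using f(2)[OF that] that by (simp add: Reals_cnj_iff)
  qed auto
  hence "cnj (cnj (f (cnj z))) = cnj (f z)" by simp
  thus ?thesis by simp
qed

text \<open>Since \<open>f\<close> and \<open>g\<close> commute with \<open>cnj\<close>, conjugating
  the identity at \<open>cnj z\<close> shows that the reflected coefficients solve it too. The
  identity is affine in the coefficients, so their average is again a solution, and on the real line
  it is the real part.\<close>

theorem real_entire_bezout:
  assumes f: "real_entire f" and g: "real_entire g" and nc: "no_common_zeros f g"
  obtains u v where "real_entire u" "real_entire v" "\<And>z. u z * f z + v z * g z = 1"
proof -
  obtain u v where u: "u holomorphic_on UNIV" and v: "v holomorphic_on UNIV"
    and uv: "\<And>z. u z * f z + v z * g z = 1"
    using entire_bezout[of f g] f g nc
    by (auto simp: real_entire_def no_common_zeros_def bezout_pair_def)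
  define sym where "sym = (\<lambda>(u::complex \<Rightarrow> complex) z. (u z + (cnj \<circ> u \<circ> cnj) z) / 2)"
  have re: "real_entire (sym u)" if "u holomorphic_on UNIV" for u
    unfolding real_entire_def sym_def
  proof (intro conjI ballI)
    have "cnj \<circ> u \<circ> cnj holomorphic_on UNIV"
      by (intro holomorphic_on_compose_cnj_cnj holomorphic_on_subset[OF that]) auto
    thus "(\<lambda>z. (u z + (cnj \<circ> u \<circ> cnj) z) / 2) holomorphic_on UNIV"
      using that unfolding o_def by (intro holomorphic_on_divide holomorphic_on_add) auto
  qed (auto simp: Reals_cnj_iff add.commute)
  show ?thesis
  proof (rule that[OF re[OF u] re[OF v]])
    fix z
    have "cnj (u (cnj z) * f (cnj z) + v (cnj z) * g (cnj z)) = 1"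
      by (simp add: uv)
    hence "cnj (u (cnj z)) * f z + cnj (v (cnj z)) * g z = 1"
      by (simp add: real_entire_cnj[OF f] real_entire_cnj[OF g])
    moreover have "sym u z * f z + sym v z * g z =
        ((u z * f z + v z * g z) + (cnj (u (cnj z)) * f z + cnj (v (cnj z)) * g z)) / 2"
      by (simp add: sym_def field_simps)
    ultimately show "sym u z * f z + sym v z * g z = 1"
      by (simp add: uv)
  qed
qed

section \<open>Absolutely continuous functions\<close>

lemma abs_continuousE:
  assumes "abs_continuous u v f" "e > 0"
  obtains d where "d > 0"
    "\<And>(n::nat) s t. (\<And>i. i < n \<Longrightarrow> u \<le> s i \<and> s i \<le> t i \<and> t i \<le> v) \<Longrightarrow>
        disjoint_family_on (\<lambda>i. {s i<..<t i}) {..<n} \<Longrightarrow> (\<Sum>i<n. t i - s i) < d \<Longrightarrow>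
        (\<Sum>i<n. norm (f (t i) - f (s i))) < e"
proof -
  obtain d where "d > 0" and *: "\<forall>n::nat. \<forall>s t. (\<forall>i<n. u \<le> s i \<and> s i \<le> t i \<and> t i \<le> v) \<and>
        disjoint_family_on (\<lambda>i. {s i<..<t i}) {..<n} \<and> (\<Sum>i<n. t i - s i) < d \<longrightarrow>
        (\<Sum>i<n. norm (f (t i) - f (s i))) < e"
    using assms(1)[unfolded abs_continuous_def, rule_format, OF assms(2)] by (elim exE conjE)
  show ?thesis
    by (rule that[OF \<open>d > 0\<close>], rule *[rule_format]) auto
qed

lemma abs_continuous_imp_continuous_on:
  assumes "abs_continuous u v f"
  shows "continuous_on {u..v} f"
  unfolding continuous_on_iff
proof (intro ballI allI impI)
  fix x e assume x: "x \<in> {u..v}" and e: "(e::real) > 0"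
  obtain d where d: "d > 0" and *: "\<And>(n::nat) s t. (\<And>i. i < n \<Longrightarrow> u \<le> s i \<and> s i \<le> t i \<and> t i \<le> v) \<Longrightarrow>
        disjoint_family_on (\<lambda>i. {s i<..<t i}) {..<n} \<Longrightarrow> (\<Sum>i<n. t i - s i) < d \<Longrightarrow>
        (\<Sum>i<n. norm (f (t i) - f (s i))) < e"
    using abs_continuousE[OF assms e] by blast
  \<comment> \<open>A family of one interval; \<open>min\<close> and \<open>max\<close> supply the
    ordered endpoints that the definition demands.\<close>
  have "dist (f y) (f x) < e" if "y \<in> {u..v}" "dist y x < d" for y
    using *[of 1 "\<lambda>_. min x y" "\<lambda>_. max x y"] x that
    by (cases "x \<le> y") (auto simp: disjoint_family_on_def dist_norm norm_minus_commute)
  with d show "\<exists>d>0. \<forall>x'\<in>{u..v}. dist x' x < d \<longrightarrow> dist (f x') (f x) < e"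
    by blast
qed

text \<open>Common source of the closure rules for linear combinations, products and congruence:
  each needs only an estimate of single increments.\<close>

lemma abs_continuous_dominated:
  assumes f: "abs_continuous u v f" and g: "abs_continuous u v g"
    and C: "\<And>s t. u \<le> s \<Longrightarrow> s \<le> t \<Longrightarrow> t \<le> v \<Longrightarrow>
              norm (h t - h s) \<le> C * (norm (f t - f s) + norm (g t - g s))"
  shows "abs_continuous u v h"
  unfolding abs_continuous_def
proof (intro allI impI)
  fix e :: real assume "e > 0"
  \<comment> \<open>\<open>C\<close> may be zero or negative, whereas \<open>e'\<close> divides by
    the constant.\<close>
  define C' where "C' = \<bar>C\<bar> + 1"
  have C': "C' > 0" "C \<le> C'" by (auto simp: C'_def)
  define e' where "e' = e / (2 * C')"
  have e': "e' > 0" using \<open>e > 0\<close> C' by (simp add: e'_def)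
  obtain d1 where d1: "d1 > 0" and *: "\<And>(n::nat) s t. (\<And>i. i < n \<Longrightarrow> u \<le> s i \<and> s i \<le> t i \<and> t i \<le> v) \<Longrightarrow>
        disjoint_family_on (\<lambda>i. {s i<..<t i}) {..<n} \<Longrightarrow> (\<Sum>i<n. t i - s i) < d1 \<Longrightarrow>
        (\<Sum>i<n. norm (f (t i) - f (s i))) < e'"
    using abs_continuousE[OF f e'] by blast
  obtain d2 where d2: "d2 > 0" and **: "\<And>(n::nat) s t. (\<And>i. i < n \<Longrightarrow> u \<le> s i \<and> s i \<le> t i \<and> t i \<le> v) \<Longrightarrow>
        disjoint_family_on (\<lambda>i. {s i<..<t i}) {..<n} \<Longrightarrow> (\<Sum>i<n. t i - s i) < d2 \<Longrightarrow>
        (\<Sum>i<n. norm (g (t i) - g (s i))) < e'"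
    using abs_continuousE[OF g e'] by blast
  show "\<exists>d>0. \<forall>n s t. (\<forall>i<n. u \<le> s i \<and> s i \<le> t i \<and> t i \<le> v) \<and>
          disjoint_family_on (\<lambda>i. {s i<..<t i}) {..<n} \<and> (\<Sum>i<n. t i - s i) < d \<longrightarrow>
          (\<Sum>i<(n::nat). norm (h (t i) - h (s i))) < e"
  proof (intro exI[of _ "min d1 d2"] conjI allI impI)
    fix n :: nat and s t
    assume A: "(\<forall>i<n. u \<le> s i \<and> s i \<le> t i \<and> t i \<le> v) \<and>
      disjoint_family_on (\<lambda>i. {s i<..<t i}) {..<n} \<and> (\<Sum>i<n. t i - s i) < min d1 d2"
    have "(\<Sum>i<n. norm (h (t i) - h (s i))) \<le>
            (\<Sum>i<n. C' * (norm (f (t i) - f (s i)) + norm (g (t i) - g (s i))))"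
    proof (rule sum_mono)
      fix i assume "i \<in> {..<n}"
      hence "norm (h (t i) - h (s i)) \<le> C * (norm (f (t i) - f (s i)) + norm (g (t i) - g (s i)))"
        using A by (intro C) auto
      also have "\<dots> \<le> C' * (norm (f (t i) - f (s i)) + norm (g (t i) - g (s i)))"
        using C' by (intro mult_right_mono) auto
      finally show "norm (h (t i) - h (s i)) \<le> \<dots>" .
    qed
    also have "\<dots> = C' * ((\<Sum>i<n. norm (f (t i) - f (s i))) + (\<Sum>i<n. norm (g (t i) - g (s i))))"
      by (simp only: sum_distrib_left[symmetric] sum.distrib)
    also have "\<dots> < C' * (e' + e')"
      using A *[of n s t] **[of n s t] C' by (intro mult_strict_left_mono add_strict_mono) auto
    also have "\<dots> = e"
      using C' by (simp add: e'_def)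
    finally show "(\<Sum>i<n. norm (h (t i) - h (s i))) < e" .
  qed (use d1 d2 in auto)
qed

lemma abs_continuous_lincomb:
  assumes "abs_continuous u v f" "abs_continuous u v g"
  shows "abs_continuous u v (\<lambda>x. A * f x + B * g x)"
proof (rule abs_continuous_dominated[OF assms, of _ "max (norm A) (norm B)"])
  fix s t
  have "A * f t + B * g t - (A * f s + B * g s) = A * (f t - f s) + B * (g t - g s)"
    by (simp add: algebra_simps)
  hence "norm (A * f t + B * g t - (A * f s + B * g s)) \<le>
      norm A * norm (f t - f s) + norm B * norm (g t - g s)"
    by (metis norm_mult norm_triangle_ineq)
  also have "\<dots> \<le> max (norm A) (norm B) * norm (f t - f s) + max (norm A) (norm B) * norm (g t - g s)"
    by (intro add_mono mult_right_mono) auto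
  finally show "norm (A * f t + B * g t - (A * f s + B * g s)) \<le>
      max (norm A) (norm B) * (norm (f t - f s) + norm (g t - g s))"
    by (simp add: distrib_left)
qed

text \<open>The increment of a product splits into increments of the factors, with coefficients
  bounded by continuity on the compact interval.\<close>

lemma abs_continuous_mult:
  assumes f: "abs_continuous u v f" and g: "abs_continuous u v g"
  shows "abs_continuous u v (\<lambda>x. f x * g x)"
proof -
  have "bounded (f ` {u..v})" "bounded (g ` {u..v})"
    by (intro compact_imp_bounded compact_continuous_image abs_continuous_imp_continuous_on f g compact_Icc)+
  then obtain M N where M: "\<And>x. x \<in> {u..v} \<Longrightarrow> norm (f x) \<le> M"
    and N: "\<And>x. x \<in> {u..v} \<Longrightarrow> norm (g x) \<le> N"
    unfolding bounded_iff by blast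
  show ?thesis
  proof (rule abs_continuous_dominated[OF f g, of _ "max M N"])
    fix s t assume st: "u \<le> s" "s \<le> t" "t \<le> v"
    have "f t * g t - f s * g s = (f t - f s) * g t + f s * (g t - g s)"
      by (simp add: algebra_simps)
    hence "norm (f t * g t - f s * g s) \<le> norm (g t) * norm (f t - f s) + norm (f s) * norm (g t - g s)"
      by (metis mult.commute norm_mult norm_triangle_ineq)
    also have "\<dots> \<le> max M N * norm (f t - f s) + max M N * norm (g t - g s)"
      using st M[of s] N[of t] by (intro add_mono mult_right_mono) auto
    finally show "norm (f t * g t - f s * g s) \<le> max M N * (norm (f t - f s) + norm (g t - g s))"
      by (simp add: distrib_left)
  qed
qed

lemma abs_continuous_cong:
  assumes "\<And>x. x \<in> {u..v} \<Longrightarrow> f x = g x" "abs_continuous u v f"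
  shows "abs_continuous u v g"
  using assms(1) by (intro abs_continuous_dominated[OF assms(2,2), of _ 1]) auto

text \<open>Tagged divisions are finite sets of pairs, so the definition, indexed by
  \<open>{..<n}\<close>, is carried over along an enumeration of \<open>P\<close>.\<close>

lemma abs_continuous_finite_family:
  assumes "abs_continuous u v f" "e > 0"
  obtains d where "d > 0"
    "\<And>P s t. finite P \<Longrightarrow> (\<And>i. i \<in> P \<Longrightarrow> u \<le> s i \<and> s i \<le> t i \<and> t i \<le> v) \<Longrightarrow>
        disjoint_family_on (\<lambda>i. {s i<..<t i}) P \<Longrightarrow> (\<Sum>i\<in>P. t i - s i) < d \<Longrightarrow>
        (\<Sum>i\<in>P. norm (f (t i) - f (s i))) < e"
proof -
  obtain d where d: "d > 0" and *: "\<And>(n::nat) s t. (\<And>i. i < n \<Longrightarrow> u \<le> s i \<and> s i \<le> t i \<and> t i \<le> v) \<Longrightarrow>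
        disjoint_family_on (\<lambda>i. {s i<..<t i}) {..<n} \<Longrightarrow> (\<Sum>i<n. t i - s i) < d \<Longrightarrow>
        (\<Sum>i<n. norm (f (t i) - f (s i))) < e"
    using abs_continuousE[OF assms] by blast
  show ?thesis
  proof (rule that[OF d])
    fix P :: "'b set" and s t
    assume P: "finite P" "\<And>i. i \<in> P \<Longrightarrow> u \<le> s i \<and> s i \<le> t i \<and> t i \<le> v"
      "disjoint_family_on (\<lambda>i. {s i<..<t i}) P" "(\<Sum>i\<in>P. t i - s i) < d"
    obtain \<pi> where \<pi>: "bij_betw \<pi> {..<card P} P"
      using ex_bij_betw_nat_finite[OF P(1)] by (auto simp: atLeast0LessThan)
    have in_P: "\<pi> i \<in> P" if "i < card P" for i
      using \<pi> that by (auto simp: bij_betw_def)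
    have "disjoint_family_on (\<lambda>i. {s (\<pi> i)<..<t (\<pi> i)}) {..<card P}"
      unfolding disjoint_family_on_def
    proof (intro ballI impI)
      fix i j assume ij: "i \<in> {..<card P}" "j \<in> {..<card P}" "i \<noteq> j"
      hence "\<pi> i \<noteq> \<pi> j"
        using \<pi> by (auto simp: bij_betw_def inj_on_def)
      thus "{s (\<pi> i)<..<t (\<pi> i)} \<inter> {s (\<pi> j)<..<t (\<pi> j)} = {}"
        using P(3) in_P ij by (auto simp: disjoint_family_on_def)
    qed
    moreover have "(\<Sum>i<card P. t (\<pi> i) - s (\<pi> i)) < d"
      using P(4) sum.reindex_bij_betw[OF \<pi>, of "\<lambda>i. t i - s i"] by simp
    ultimately have "(\<Sum>i<card P. norm (f (t (\<pi> i)) - f (s (\<pi> i)))) < e"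
      using P(2) in_P *[of "card P" "\<lambda>i. s (\<pi> i)" "\<lambda>i. t (\<pi> i)"] by auto
    thus "(\<Sum>i\<in>P. norm (f (t i) - f (s i))) < e"
      using sum.reindex_bij_betw[OF \<pi>, of "\<lambda>i. norm (f (t i) - f (s i))"] by simp
  qed
qed

section \<open>Derivative zero almost everywhere\<close>

text \<open>Outer regularity bounds the measure of \<open>T - N\<close>; putting the null set
  \<open>N\<close> back does not change it.\<close>

lemma negligible_outer_open:
  fixes N :: "real set"
  assumes "negligible N" "d > 0"
  obtains T where "open T" "N \<subseteq> T" "T \<in> lmeasurable" "measure lebesgue T < d"
proof -
  have N: "N \<in> null_sets lebesgue"
    using assms by (simp add: negligible_iff_null_sets)
  obtain T where T: "open T" "N \<subseteq> T" "T - N \<in> lmeasurable" "emeasure lebesgue (T - N) < ennreal d"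
    using sets_lebesgue_outer_open[OF _ assms(2), of N] N by (auto simp: null_sets_def)
  have TN: "T = (T - N) \<union> N" using T by auto
  have "emeasure lebesgue T = emeasure lebesgue (T - N)"
    using T(3) N by (subst TN, intro emeasure_Un_null_set) auto
  with T have "emeasure lebesgue T < ennreal d" by simp
  moreover from this have "T \<in> lmeasurable"
    using T(1) by (intro fmeasurableI) (auto intro: less_trans)
  ultimately have "measure lebesgue T < d"
    by (simp add: emeasure_eq_measure2 ennreal_less_iff)
  with T \<open>T \<in> lmeasurable\<close> show ?thesis
    by (intro that)
qed

text \<open>
  A gauge argument: on a tagged division whose tags in the exceptional null set have their
  intervals inside an open set of small measure, absolute continuity controls the increments there,
  and the vanishing derivative controls all others.
\<close>

lemma abs_continuous_zero_derivative_constant: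
  assumes ac: "abs_continuous u v f" and "u \<le> v" and N: "negligible N"
    and deriv: "\<And>x. x \<in> {u..v} - N \<Longrightarrow> (f has_vector_derivative 0) (at x within {u..v})"
  shows "f v = f u"
proof -
  have small: "norm (f v - f u) \<le> e" if "e > 0" for e
  proof -
    \<comment> \<open>The slope is chosen so that increments over a total length
      \<open>v - u\<close> use up at most half of \<open>e\<close>; the added 1 covers
      \<open>u = v\<close>.\<close>
    define \<eta> where "\<eta> = e / (2 * (v - u + 1))"
    have \<eta>: "\<eta> > 0" "\<eta> * (v - u) \<le> e / 2"
      using \<open>e > 0\<close> \<open>u \<le> v\<close> by (auto simp: \<eta>_def field_simps)
    obtain d where d: "d > 0" and ac': "\<And>P s t. finite P \<Longrightarrow>
        (\<And>i. i \<in> P \<Longrightarrow> u \<le> s i \<and> s i \<le> t i \<and> t i \<le> v) \<Longrightarrow>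
        disjoint_family_on (\<lambda>i. {s i<..<t i}) (P::(real \<times> real set) set) \<Longrightarrow> (\<Sum>i\<in>P. t i - s i) < d \<Longrightarrow>
        (\<Sum>i\<in>P. norm (f (t i) - f (s i))) < e / 2"
      using abs_continuous_finite_family[OF ac half_gt_zero[OF \<open>e > 0\<close>]] by blast
    obtain T where T: "open T" "N \<subseteq> T" "T \<in> lmeasurable" "measure lebesgue T < d"
      using negligible_outer_open[OF N d] .
    have "\<exists>r>0. x \<in> {u..v} - N \<longrightarrow>
            (\<forall>y\<in>{u..v}. norm (y - x) < r \<longrightarrow> norm (f y - f x) \<le> \<eta> * norm (y - x))" for x
    proof (cases "x \<in> {u..v} - N")
      case True
      from deriv[OF this] \<eta>(1) show ?thesis
        unfolding has_vector_derivative_def has_derivative_within_alt by auto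
    qed (auto intro: exI[of _ 1])
    then obtain r where r: "\<And>x. r x > 0" "\<And>x y. x \<in> {u..v} - N \<Longrightarrow> y \<in> {u..v} \<Longrightarrow>
        norm (y - x) < r x \<Longrightarrow> norm (f y - f x) \<le> \<eta> * norm (y - x)"
      by metis
    define G where "G = (\<lambda>x. if x \<in> N then T else ball x (r x))"
    have "gauge G"
      using T r by (auto simp: gauge_def G_def)
    then obtain p where p: "p tagged_division_of {u..v}" "G fine p"
      using fine_division_exists_real by blast
    have fin: "finite p" using p by auto
    have elem: "\<exists>s t. K = {s..t} \<and> s \<le> x \<and> x \<le> t \<and> u \<le> s \<and> t \<le> v \<and> {s..t} \<subseteq> G x \<and> Inf K = s \<and> Sup K = t"
      if xK: "(x, K) \<in> p" for x K
    proof -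
      obtain s t where K: "K = {s..t}"
        using tagged_division_ofD(4)[OF p(1) xK] by auto
      moreover have "x \<in> K" "K \<subseteq> {u..v}"
        using tagged_division_ofD(2,3)[OF p(1) xK] by auto
      moreover have "K \<subseteq> G x"
        using p(2) xK by (auto simp: fine_def)
      ultimately show ?thesis by auto
    qed
    \<comment> \<open>Each element of the division is a closed interval, nonempty because it
      contains its tag, so \<open>Inf\<close> and \<open>Sup\<close> recover its endpoints.\<close>
    define len where "len = (\<lambda>i::real \<times> real set. Sup (snd i) - Inf (snd i))"
    define inc where "inc = (\<lambda>i::real \<times> real set. f (Sup (snd i)) - f (Inf (snd i)))"
    define p1 where "p1 = {i \<in> p. fst i \<in> N}"
    define p2 where "p2 = {i \<in> p. fst i \<notin> N}"
    have p12: "finite p1" "finite p2" "p = p1 \<union> p2" "p1 \<inter> p2 = {}"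
      using fin by (auto simp: p1_def p2_def)
    have len_nonneg: "len i \<ge> 0" if "i \<in> p" for i
      using elem[of "fst i" "snd i"] that by (auto simp: len_def)
    have sum_inc: "f v - f u = sum inc p"
      using additive_tagged_division_1[OF \<open>u \<le> v\<close> p(1), of f]
      by (simp add: inc_def case_prod_beta)
    have sum_len: "sum len p = v - u"
      using additive_tagged_division_1[OF \<open>u \<le> v\<close> p(1), of "\<lambda>x. x"]
      by (simp add: len_def case_prod_beta)
    \<comment> \<open>The tag \<open>x\<close> lies between the endpoints \<open>s\<close> and
      \<open>t\<close>, so the slope estimates from \<open>x\<close> to either side add up to
      \<open>\<eta> * (t - s)\<close>.\<close>
    have "norm (sum inc p2) \<le> (\<Sum>i\<in>p2. \<eta> * len i)"
    proof (rule sum_norm_le)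
      fix i assume "i \<in> p2"
      then obtain x K where i: "i = (x, K)" "(x, K) \<in> p" "x \<notin> N"
        by (cases i) (auto simp: p2_def)
      obtain s t where st: "s \<le> x" "x \<le> t" "u \<le> s" "t \<le> v" "{s..t} \<subseteq> G x" "Inf K = s" "Sup K = t"
        using elem[OF i(2)] by blast
      have "{s..t} \<subseteq> ball x (r x)"
        using st(5) i(3) by (simp only: G_def if_False)
      hence "s \<in> ball x (r x)" "t \<in> ball x (r x)"
        by (rule subsetD, use st in simp)+
      hence "norm (f s - f x) \<le> \<eta> * norm (s - x)" "norm (f t - f x) \<le> \<eta> * norm (t - x)"
        using st i(3) by (intro r(2); simp add: dist_norm)+
      moreover have "norm (f t - f s) \<le> norm (f t - f x) + norm (f s - f x)"
        using norm_triangle_ineq4[of "f t - f x" "f s - f x"] by simp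
      moreover have "\<eta> * norm (t - x) + \<eta> * norm (s - x) = \<eta> * (t - s)"
        using st by (simp add: algebra_simps)
      ultimately show "norm (inc i) \<le> \<eta> * len i"
        using i st by (simp add: inc_def len_def)
    qed
    also have "\<dots> \<le> \<eta> * sum len p"
      unfolding sum_distrib_left[symmetric] using \<eta>(1) p12 len_nonneg fin
      by (intro mult_left_mono sum_mono2) auto
    also have "\<dots> \<le> e / 2"
      using \<eta>(2) sum_len by simp
    finally have 2: "norm (sum inc p2) \<le> e / 2" .
    let ?I = "\<lambda>i::real \<times> real set. {Inf (snd i)<..<Sup (snd i)}"
    have disj: "disjoint_family_on ?I p1"
      unfolding disjoint_family_on_def
    proof (intro ballI impI)
      fix i j assume ij: "i \<in> p1" "j \<in> p1" "i \<noteq> j"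
      have "interior (snd i) \<inter> interior (snd j) = {}"
        using tagged_division_ofD(5)[OF p(1), of "fst i" "snd i" "fst j" "snd j"] ij
        by (auto simp: p1_def prod_eq_iff)
      moreover have "interior (snd k) = ?I k" if "k \<in> p1" for k
      proof -
        have "snd k = {Inf (snd k)..Sup (snd k)}"
          using elem[of "fst k" "snd k"] that by (auto simp: p1_def)
        thus ?thesis
          by (metis interior_atLeastAtMost_real)
      qed
      ultimately show "?I i \<inter> ?I j = {}"
        using ij by simp
    qed
    \<comment> \<open>Intervals with tags in \<open>N\<close> are disjoint up to endpoints and lie
      in \<open>T\<close>. Their total length is thus below \<open>d\<close>, and absolute
      continuity bounds the sum of their increments.\<close>
    have "sum len p1 = (\<Sum>i\<in>p1. measure lebesgue (?I i))"
      using len_nonneg by (intro sum.cong) (auto simp: len_def p1_def)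
    also have "\<dots> = measure lebesgue (\<Union>i\<in>p1. ?I i)"
    proof (intro measure_finite_Union[symmetric] disj p12)
      show "emeasure lebesgue (?I i) \<noteq> \<infinity>" for i
        by (cases "Inf (snd i) \<le> Sup (snd i)") auto
    qed auto
    also have "\<dots> \<le> measure lebesgue T"
    proof (rule measure_mono_fmeasurable)
      show "(\<Union>i\<in>p1. ?I i) \<subseteq> T"
      proof (intro UN_least)
        fix i assume "i \<in> p1"
        with elem[of "fst i" "snd i"] obtain s t
          where "{s..t} \<subseteq> G (fst i)" "Inf (snd i) = s" "Sup (snd i) = t" "fst i \<in> N"
          by (auto simp: p1_def)
        thus "?I i \<subseteq> T" by (auto simp: G_def)
      qed
      show "(\<Union>i\<in>p1. ?I i) \<in> sets lebesgue"
        using p12 by (intro sets.finite_UN) auto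
    qed (use T in auto)
    finally have "sum len p1 < d"
      using T by simp
    moreover have "u \<le> Inf (snd i) \<and> Inf (snd i) \<le> Sup (snd i) \<and> Sup (snd i) \<le> v" if "i \<in> p1" for i
      using elem[of "fst i" "snd i"] that by (auto simp: p1_def)
    ultimately have "(\<Sum>i\<in>p1. norm (inc i)) < e / 2"
      using ac'[of p1 "\<lambda>i. Inf (snd i)" "\<lambda>i. Sup (snd i)"] p12 disj by (simp add: len_def inc_def)
    moreover have "norm (sum inc p1) \<le> (\<Sum>i\<in>p1. norm (inc i))"
      by (rule norm_sum)
    moreover have "norm (f v - f u) \<le> norm (sum inc p1) + norm (sum inc p2)"
      unfolding sum_inc p12(3) using p12 by (subst sum.union_disjoint) (auto intro: norm_triangle_ineq)
    ultimately show ?thesis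
      using 2 by linarith
  qed
  have "norm (f v - f u) \<le> 0"
    by (rule field_le_epsilon) (unfold add_0, rule small)
  thus ?thesis by simp
qed

section \<open>Solutions and Wronskians\<close>

lemma dx_lincomb:
  assumes "f differentiable at x" "g differentiable at x"
  shows "dx (\<lambda>x. A * f x + B * g x) x = A * dx f x + B * dx g x"
  using assms
  by (intro vector_derivative_at has_vector_derivative_add has_vector_derivative_mult_right)
     (auto simp: vector_derivative_works)

lemma solution_AE:
  assumes "solution I q z f"
  shows "AE x in lebesgue. x \<in> I \<longrightarrow>
           (dx f has_vector_derivative (of_real (q x) * f x - z * f x)) (at x)"
  using assms by (simp add: solution_def tau_eq_def)

lemma solution_lincomb:
  assumes I: "open I" and f: "solution I q z f" and g: "solution I q z g"
  shows "solution I q z (\<lambda>x. A * f x + B * g x)"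
proof -
  let ?h = "\<lambda>x. A * f x + B * g x"
  have diff: "f differentiable at x" "g differentiable at x" if "x \<in> I" for x
    using f g that by (auto simp: solution_def dom_tau_def)
  have dxh: "dx ?h x = A * dx f x + B * dx g x" if "x \<in> I" for x
    using dx_lincomb diff[OF that] .
  have "AC_loc I ?h"
    using f g unfolding AC_loc_def solution_def dom_tau_def by (auto intro!: abs_continuous_lincomb)
  moreover have "AC_loc I (dx ?h)"
    unfolding AC_loc_def
  proof (intro allI impI)
    fix u v assume uv: "{u..v} \<subseteq> I"
    have "abs_continuous u v (\<lambda>x. A * dx f x + B * dx g x)"
      using f g uv unfolding AC_loc_def solution_def dom_tau_def by (auto intro!: abs_continuous_lincomb)
    thus "abs_continuous u v (dx ?h)"
      by (rule abs_continuous_cong[rotated]) (use dxh uv in auto)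
  qed
  moreover have "tau_eq I q ?h (\<lambda>x. z * ?h x)"
    using solution_AE[OF f] solution_AE[OF g] unfolding tau_eq_def
  proof eventually_elim
    case (elim x)
    show ?case
    proof
      assume x: "x \<in> I"
      have "((\<lambda>x. A * dx f x + B * dx g x) has_vector_derivative
              A * (of_real (q x) * f x - z * f x) + B * (of_real (q x) * g x - z * g x)) (at x)"
        using elim x by (intro has_vector_derivative_add has_vector_derivative_mult_right) auto
      \<comment> \<open>The formula for \<open>dx ?h\<close> is known only on \<open>I\<close>; as
        \<open>I\<close> is open, it holds near \<open>x\<close>, which is enough to differentiate
        once more.\<close>
      hence "(dx ?h has_vector_derivative
              A * (of_real (q x) * f x - z * f x) + B * (of_real (q x) * g x - z * g x)) (at x)"
        by (rule has_vector_derivative_transform_within_open[OF _ I x]) (simp add: dxh)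
      thus "(dx ?h has_vector_derivative of_real (q x) * ?h x - z * ?h x) (at x)"
        by (simp add: algebra_simps)
    qed
  qed
  moreover have "?h differentiable at x" if "x \<in> I" for x
    using diff[OF that] by (intro derivative_intros) auto
  ultimately show ?thesis
    by (simp add: solution_def dom_tau_def)
qed

section \<open>Wronskians of solutions\<close>

text \<open>The Wronskian is bilinear and alternating, so the determinant of the coefficients
  factors out.\<close>

lemma wronskian_lincomb:
  assumes "f differentiable at x" "g differentiable at x"
  shows "wronskian (\<lambda>x. A * f x + B * g x) (\<lambda>x. C * f x + D * g x) x = (A * D - C * B) * wronskian f g x"
  unfolding wronskian_def dx_lincomb[OF assms] by (simp add: algebra_simps)

text \<open>The first-derivative products cancel in the derivative of the Wronskian. What remains is
  \<open>f g'' - f'' g\<close>, and it vanishes off a null set because both functions solve the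
  equation with the same \<open>z\<close>.\<close>

lemma wronskian_solutions_eq:
  assumes f: "solution I q z f" and g: "solution I q z g" and "u \<le> v" and uv: "{u..v} \<subseteq> I"
  shows "wronskian f g v = wronskian f g u"
proof -
  have ac: "abs_continuous u v f" "abs_continuous u v g" "abs_continuous u v (dx f)" "abs_continuous u v (dx g)"
    using f g uv by (auto simp: solution_def dom_tau_def AC_loc_def)
  have "abs_continuous u v (\<lambda>x. 1 * (f x * dx g x) + (-1) * (dx f x * g x))"
    by (intro abs_continuous_lincomb abs_continuous_mult ac)
  hence "abs_continuous u v (wronskian f g)"
    by (simp add: wronskian_def[abs_def])
  have "AE x in lebesgue. x \<in> I \<longrightarrow>
          (dx f has_vector_derivative (of_real (q x) * f x - z * f x)) (at x) \<and>
          (dx g has_vector_derivative (of_real (q x) * g x - z * g x)) (at x)"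
    using solution_AE[OF f] solution_AE[OF g] by eventually_elim blast
  then obtain N where N: "N \<in> null_sets lebesgue"
    and dd: "\<And>x. x \<in> I - N \<Longrightarrow>
          (dx f has_vector_derivative (of_real (q x) * f x - z * f x)) (at x) \<and>
          (dx g has_vector_derivative (of_real (q x) * g x - z * g x)) (at x)"
    by (auto elim!: AE_E3)
  show ?thesis
  proof (rule abs_continuous_zero_derivative_constant[OF \<open>abs_continuous u v (wronskian f g)\<close> \<open>u \<le> v\<close>])
    show "negligible N"
      using N by (simp add: negligible_iff_null_sets)
    fix x assume x: "x \<in> {u..v} - N"
    hence xI: "x \<in> I - N" using uv by auto
    have "f differentiable at x" "g differentiable at x"
      using f g xI by (auto simp: solution_def dom_tau_def)
    hence "(f has_vector_derivative dx f x) (at x)" "(g has_vector_derivative dx g x) (at x)"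
      by (auto simp: vector_derivative_works)
    hence "((\<lambda>x. f x * dx g x - dx f x * g x) has_vector_derivative
        (f x * (of_real (q x) * g x - z * g x) + dx f x * dx g x) -
        (dx f x * dx g x + (of_real (q x) * f x - z * f x) * g x)) (at x)"
      using dd[OF xI] by (intro has_vector_derivative_diff has_vector_derivative_mult) auto
    hence "(wronskian f g has_vector_derivative 0) (at x)"
      by (simp add: wronskian_def[abs_def] algebra_simps)
    thus "(wronskian f g has_vector_derivative 0) (at x within {u..v})"
      by (rule has_vector_derivative_at_within)
  qed
qed

lemma wronskian_solutions_constant:
  assumes "solution (einterval a b) q z f" "solution (einterval a b) q z g"
    and x: "x \<in> einterval a b" "y \<in> einterval a b"
  shows "wronskian f g x = wronskian f g y"
proof -
  \<comment> \<open>Order convexity of the interval; the two points can then be compared in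
    whichever order they occur.\<close>
  have *: "{s..t} \<subseteq> einterval a b" if "s \<in> einterval a b" "t \<in> einterval a b" for s t
  proof
    fix x assume "x \<in> {s..t}"
    hence "ereal s \<le> ereal x" "ereal x \<le> ereal t" by auto
    with that show "x \<in> einterval a b"
      unfolding einterval_iff by (metis less_le_trans le_less_trans)
  qed
  show ?thesis
    using wronskian_solutions_eq[OF assms(1,2) _ *] x by (metis linear)
qed

section \<open>Construction of the second solution\<close>

theorem lemma2p4:
  fixes a b :: ereal and c :: real
    and q :: "real \<Rightarrow> real"
    and v w :: "real \<Rightarrow> complex"
    and H :: l2_graph
    and cs sn \<phi> :: "complex \<Rightarrow> real \<Rightarrow> complex"
    and \<alpha> \<beta> :: "complex \<Rightarrow> complex"
  assumes "a < b"
    and "L1_loc (einterval a b) q"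
    and "separated_realization a b q v w H"
    and "c \<in> einterval a b"
    and "\<And>z. solution (einterval a b) q z (cs z) \<and> cs z c = 1 \<and> dx (cs z) c = 0"
    and "\<And>z. solution (einterval a b) q z (sn z) \<and> sn z c = 0 \<and> dx (sn z) c = 1"
    and "purely_discrete_spectrum (einterval a (ereal c)) (dirichlet_restriction a b q v c)"
    and "real_entire \<alpha>" and "real_entire \<beta>" and "no_common_zeros \<alpha> \<beta>"
    and "\<phi> = (\<lambda>z x. \<alpha> z * cs z x + \<beta> z * sn z x)"
    and "\<And>z. solution (einterval a b) q z (\<phi> z)"
    and "\<And>z. in_domain_near (einterval a b) q (left_end a) v (\<phi> z)"
  shows "\<exists>\<gamma> \<delta> \<theta>.
           real_entire \<gamma> \<and> real_entire \<delta> \<and> no_common_zeros \<gamma> \<delta> \<and>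
           \<theta> = (\<lambda>z x. \<gamma> z * cs z x + \<delta> z * sn z x) \<and>
           (\<forall>z. solution (einterval a b) q z (\<theta> z)) \<and>
           (\<forall>z. \<forall>x\<in>einterval a b. wronskian (\<theta> z) (\<phi> z) x = \<gamma> z * \<beta> z - \<alpha> z * \<delta> z) \<and>
           (\<forall>z. \<gamma> z * \<beta> z - \<alpha> z * \<delta> z = 1)"
proof -
  let ?I = "einterval a b"
  \<comment> \<open>\<open>\<beta>\<close> is passed first, so that \<open>\<gamma>\<close> becomes
    its cofactor as in the Wronskian; the other sign is absorbed into \<open>\<delta>\<close>
    below.\<close>
  obtain \<gamma> \<delta>' where re: "real_entire \<gamma>" "real_entire \<delta>'"
    and bezout: "\<And>z. \<gamma> z * \<beta> z + \<delta>' z * \<alpha> z = 1"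
    using real_entire_bezout[of \<beta> \<alpha>] assms(8-10) by (auto simp: no_common_zeros_def)
  define \<delta> where "\<delta> = (\<lambda>z. - \<delta>' z)"
  have \<delta>: "real_entire \<delta>"
    using re(2) by (auto simp: \<delta>_def real_entire_def intro!: holomorphic_intros)
  have W1: "\<gamma> z * \<beta> z - \<alpha> z * \<delta> z = 1" for z
    using bezout[of z] by (simp add: \<delta>_def mult.commute)
  have nc: "no_common_zeros \<gamma> \<delta>"
    using W1 unfolding no_common_zeros_def by (metis diff_self mult_zero_left mult_zero_right zero_neq_one)
  have cs: "solution ?I q z (cs z)" and sn: "solution ?I q z (sn z)" for z
    using assms(5,6) by auto
  define \<theta> where "\<theta> = (\<lambda>z x. \<gamma> z * cs z x + \<delta> z * sn z x)"
  have sol: "solution ?I q z (\<theta> z)" for z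
    unfolding \<theta>_def using cs sn by (intro solution_lincomb) auto
  have wr: "wronskian (\<theta> z) (\<phi> z) x = \<gamma> z * \<beta> z - \<alpha> z * \<delta> z" if x: "x \<in> ?I" for z x
  proof -
    have "cs z differentiable at x" "sn z differentiable at x"
      using cs sn x by (auto simp: solution_def dom_tau_def)
    hence "wronskian (\<theta> z) (\<phi> z) x = (\<gamma> z * \<beta> z - \<alpha> z * \<delta> z) * wronskian (cs z) (sn z) x"
      unfolding \<theta>_def assms(11) by (rule wronskian_lincomb)
    \<comment> \<open>Constancy moves the evaluation to \<open>c\<close>, where the initial values
      make this Wronskian equal to 1.\<close>
    also have "wronskian (cs z) (sn z) x = wronskian (cs z) (sn z) c"
      using cs sn x assms(4) by (rule wronskian_solutions_constant)
    also have "\<dots> = 1"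
      using assms(5,6) by (simp add: wronskian_def)
    finally show ?thesis by simp
  qed
  show ?thesis
    using re(1) \<delta> nc sol wr W1 \<theta>_def by blast
qed

end
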